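(* Let $(\mathcal{X},d)$ be a finite metric space, $P$ a probability distribution on $\mathcal{X}$, $k\ge1$ an integer, and $O\in\mathcal{X}_k$ an optimal $k$-RP solution. Let $S$ be the random $k$-multiset returned by algorithm VRRP, i.e., $S\sim\widetilde{P}_k$. Then $$\mathbb{E}_{S\sim \widetilde{P}_k}\mathbb{E}_{X\sim P_k}[d_k(S,X)]\le 4\cdot \mathbb{E}_{X\sim P_k}[d_k(O,X)].$$
   Context: $\mathcal{X}_k$ is the set of multisets of exactly $k$ points of $\mathcal{X}$. For $U,V\in\mathcal{X}_k$, $d_k(U,V)$ is the minimum, over perfect matchings between the $k$ elements of $U$ and the $k$ elements of $V$ (with multiplicity), of the sum of the distances of matched pairs. $P_k$ is the distribution of the multiset of $k$ points drawn i.i.d. from $P$. The $k$-RP cost of $S\in\mathcal{X}_k$ is $\mathbb{E}_{X\sim P_k}[d_k(S,X)]$, and $O$ minimizes this cost. The variance-reduced distribution $\widetilde{P}_k$ on $\mathcal{X}_k$ (algorithm VRRP) is defined as follows: for each $x\in\mathcal{X}$ the multiset contains $\lfloor P(x)\cdot k\rfloor$ copies of $x$; each of the remaining $r=k-\sum_{x\in\mathcal{X}}\lfloor P(x)\cdot k\rfloor$ points (if $r>0$) is chosen independently, equal to $x$ with probability $\frac{P(x)-\lfloor P(x)k\rfloor/k}{\sum_{y\in\mathcal{X}}(P(y)-\lfloor P(y)k\rfloor/k)}$. *)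

theory Defs
  imports "HOL-Probability.Probability" "HOL-Library.Multiset"
begin

definition finite_metric_space :: "'a set \<Rightarrow> ('a \<Rightarrow> 'a \<Rightarrow> real) \<Rightarrow> bool" where
  "finite_metric_space X d \<longleftrightarrow> finite X \<and> X \<noteq> {} \<and>
     (\<forall>x\<in>X. \<forall>y\<in>X. d x y = 0 \<longleftrightarrow> x = y) \<and>
     (\<forall>x\<in>X. \<forall>y\<in>X. d x y = d y x) \<and>
     (\<forall>x\<in>X. \<forall>y\<in>X. \<forall>z\<in>X. d x z \<le> d x y + d y z)"

definition kmsets :: "'a set \<Rightarrow> nat \<Rightarrow> 'a multiset set" where
  "kmsets X k = {M. size M = k \<and> set_mset M \<subseteq> X}"

text \<open>d_k(U,V): minimum over perfect matchings (with multiplicity) of the total distance.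
  A perfect matching is given by listing U and V in some orders and pairing positions.\<close>
definition dk :: "('a \<Rightarrow> 'a \<Rightarrow> real) \<Rightarrow> 'a multiset \<Rightarrow> 'a multiset \<Rightarrow> real" where
  "dk d U V = Min {(\<Sum>i<size U. d (xs ! i) (ys ! i)) | xs ys. mset xs = U \<and> mset ys = V}"

fun iid_mset :: "'a pmf \<Rightarrow> nat \<Rightarrow> 'a multiset pmf" where
  "iid_mset Q 0 = return_pmf {#}"
| "iid_mset Q (Suc n) = bind_pmf Q (\<lambda>x. map_pmf (add_mset x) (iid_mset Q n))"

definition rp_cost :: "('a \<Rightarrow> 'a \<Rightarrow> real) \<Rightarrow> 'a pmf \<Rightarrow> nat \<Rightarrow> 'a multiset \<Rightarrow> real" where
  "rp_cost d P k S = measure_pmf.expectation (iid_mset P k) (\<lambda>Y. dk d S Y)"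

definition vr_fixed :: "'a set \<Rightarrow> 'a pmf \<Rightarrow> nat \<Rightarrow> 'a multiset" where
  "vr_fixed X P k = (\<Sum>x\<in>X. replicate_mset (nat \<lfloor>pmf P x * real k\<rfloor>) x)"

definition vr_resid_weight :: "'a pmf \<Rightarrow> nat \<Rightarrow> 'a \<Rightarrow> real" where
  "vr_resid_weight P k x = pmf P x - real (nat \<lfloor>pmf P x * real k\<rfloor>) / real k"

definition vr_resid :: "'a set \<Rightarrow> 'a pmf \<Rightarrow> nat \<Rightarrow> 'a pmf" where
  "vr_resid X P k = embed_pmf (\<lambda>x. if x \<in> X then vr_resid_weight P k x / (\<Sum>y\<in>X. vr_resid_weight P k y) else 0)"

definition vrrp :: "'a set \<Rightarrow> 'a pmf \<Rightarrow> nat \<Rightarrow> 'a multiset pmf" where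
  "vrrp X P k = map_pmf (\<lambda>M. vr_fixed X P k + M)
      (iid_mset (vr_resid X P k) (k - size (vr_fixed X P k)))"

end

(* VRRP draws k independent points whose laws average to P, and drawing all k points from P itself
   only increases the expected cost (a Hoeffding-type comparison): moving two laws p + h and p - h
   towards p changes the expectation of g by a positive multiple of the quadratic form
   sum h(x) h(y) g(M + x + y). For the matching distance g = d_k(., Y) this form is nonnegative on
   weights h of sum 0: an alternating-path exchange gives a four-point condition, by which
   K(x,y) - K(x,w) - K(y,w), with K(x,y) = g(M + x + y), is an ultrametric similarity, and such a
   similarity is a constant plus a nonnegative combination of indicators of partial equivalence
   relations. The triangle inequality through O bounds the cost of an i.i.d. sample by twice the
   cost of O, which gives the factor 2, hence 4. *)
theory Submission
  imports Defs
begin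

section \<open>Matchings as multisets of pairs, and the triangle inequality\<close>

text \<open>Pairing two orderings by position amounts to a multiset of pairs with marginals
  \<open>U\<close> and \<open>V\<close>, and a multiset has finitely many orderings, so the
  \<open>Min\<close> is attained. Later arguments about matchings use this multiset form.\<close>

lemma dk_attained_and_le:
  fixes d :: "'a \<Rightarrow> 'a \<Rightarrow> real"
  assumes sz: "size U = size V"
  shows dk_attained: "\<exists>M. image_mset fst M = U \<and> image_mset snd M = V \<and>
           dk d U V = (\<Sum>(a,b)\<in>#M. d a b)"
    and dk_le: "image_mset fst M = U \<Longrightarrow> image_mset snd M = V \<Longrightarrow>
           dk d U V \<le> (\<Sum>(a,b)\<in>#M. d a b)"
proof -
  let ?S = "{(\<Sum>i<size U. d (xs ! i) (ys ! i)) | xs ys. mset xs = U \<and> mset ys = V}"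
  have cost: "(\<Sum>i<length ps. d (map fst ps ! i) (map snd ps ! i)) = (\<Sum>(a,b)\<in>#mset ps. d a b)" for ps
    by (simp add: sum_mset_sum_list sum_list_sum_nth atLeast0LessThan case_prod_beta
        flip: mset_map)
  have fin: "finite ?S"
  proof -
    have "?S = (\<lambda>(xs,ys). \<Sum>i<size U. d (xs ! i) (ys ! i)) `
        ({xs. mset xs = U} \<times> {ys. mset ys = V})"
      by auto
    moreover have "finite ({xs. mset xs = U} \<times> {ys. mset ys = V})"
      using ex_mset[of U] ex_mset[of V]
      by (auto intro!: finite_cartesian_product mset_eq_finite)
    ultimately show ?thesis
      by (metis (no_types, lifting) finite_imageI)
  qed
  obtain us vs where "mset us = U" "mset vs = V"
    by (metis ex_mset)
  then have "?S \<noteq> {}"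
    by blast
  with fin have "dk d U V \<in> ?S"
    unfolding dk_def by (rule Min_in)
  then obtain xs ys where *: "dk d U V = (\<Sum>i<size U. d (xs ! i) (ys ! i))"
      "mset xs = U" "mset ys = V"
    by blast
  then have len: "length xs = length ys" "size U = length xs"
    using sz by (metis size_mset)+
  have "image_mset fst (mset (zip xs ys)) = U" "image_mset snd (mset (zip xs ys)) = V"
    using * len by (simp_all flip: mset_map)
  moreover have "dk d U V = (\<Sum>(a,b)\<in>#mset (zip xs ys). d a b)"
    using cost[of "zip xs ys"] * len by simp
  ultimately show "\<exists>M. image_mset fst M = U \<and> image_mset snd M = V \<and>
           dk d U V = (\<Sum>(a,b)\<in>#M. d a b)"
    by blast
  show "dk d U V \<le> (\<Sum>(a,b)\<in>#M. d a b)"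
    if "image_mset fst M = U" "image_mset snd M = V" for M
  proof -
    obtain ps where ps: "M = mset ps"
      by (metis ex_mset)
    have "size U = length ps"
      using that ps by (metis size_image_mset size_mset)
    then have "(\<Sum>(a,b)\<in>#M. d a b) = (\<Sum>i<size U. d (map fst ps ! i) (map snd ps ! i))"
      using cost[of ps] ps by simp
    moreover have "mset (map fst ps) = U" "mset (map snd ps) = V"
      using that ps by simp_all
    ultimately have "(\<Sum>(a,b)\<in>#M. d a b) \<in> ?S"
      by blast
    with fin show ?thesis
      unfolding dk_def by (rule Min_le)
  qed
qed

lemma dk_nonneg:
  assumes "size U = size V" and "\<And>a b. a \<in># U \<Longrightarrow> b \<in># V \<Longrightarrow> 0 \<le> d a b"
  shows "0 \<le> dk d U V"
proof -
  obtain M where M: "image_mset fst M = U" "image_mset snd M = V"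
      "dk d U V = (\<Sum>(a,b)\<in>#M. d a b)"
    using dk_attained[OF assms(1), of d] by blast
  have "0 \<le> d (fst p) (snd p)" if "p \<in># M" for p
    using M that assms(2) by (metis image_eqI set_image_mset)
  then show ?thesis
    unfolding M(3) by (induction M) auto
qed

text \<open>Two matchings that share a side can be glued along it: \<open>dk_triangle\<close> glues
  along \<open>fst\<close>, \<open>dk_four_point\<close> along \<open>snd\<close>.\<close>

lemma joint_matching:
  assumes "image_mset f M = image_mset g N"
  shows "\<exists>T. image_mset fst T = M \<and> image_mset snd T = N \<and> (\<forall>(p,q)\<in>#T. f p = g q)"
  using assms
proof (induction M arbitrary: N)
  case empty
  then show ?case by simp
next
  case (add p M)
  then obtain q N' where N: "N = add_mset q N'" "f p = g q" "image_mset f M = image_mset g N'"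
    by (metis image_mset_add_mset msed_map_invR)
  from add.IH[OF N(3)] obtain T where T: "image_mset fst T = M" "image_mset snd T = N'"
      "\<forall>(p,q)\<in>#T. f p = g q"
    by blast
  show ?case
    by (rule exI[of _ "add_mset (p,q) T"]) (use T N in auto)
qed

text \<open>Compose optimal matchings of \<open>W\<close> with \<open>U\<close> and of
  \<open>W\<close> with \<open>V\<close> along \<open>W\<close>. The triangle hypothesis has
  \<open>c\<close> first because both matchings start in \<open>W\<close>.\<close>

lemma dk_triangle:
  assumes sz: "size U = size W" "size V = size W"
    and tri: "\<And>a b c. a \<in># U \<Longrightarrow> b \<in># V \<Longrightarrow> c \<in># W \<Longrightarrow> d a b \<le> d c a + d c b"
  shows "dk d U V \<le> dk d W U + dk d W V"
proof -
  obtain M where M: "image_mset fst M = W" "image_mset snd M = U"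
      "dk d W U = (\<Sum>(a,b)\<in>#M. d a b)"
    using dk_attained[of W U d] sz by auto
  obtain N where N: "image_mset fst N = W" "image_mset snd N = V"
      "dk d W V = (\<Sum>(a,b)\<in>#N. d a b)"
    using dk_attained[of W V d] sz by auto
  obtain T where T: "image_mset fst T = M" "image_mset snd T = N" "\<forall>(p,q)\<in>#T. fst p = fst q"
    using joint_matching[of fst M fst N] M N by auto
  let ?T = "image_mset (\<lambda>(p,q). (snd p, snd q)) T"
  have "image_mset fst ?T = U" "image_mset snd ?T = V"
    using M(2) N(2) by (simp_all add: T(1,2)[symmetric] image_mset.compositionality comp_def case_prod_beta)
  then have "dk d U V \<le> (\<Sum>(a,b)\<in>#?T. d a b)"
    using dk_le[of U V ?T d] sz by simp
  also have "\<dots> = (\<Sum>t\<in>#T. d (snd (fst t)) (snd (snd t)))"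
    by (simp add: image_mset.compositionality comp_def case_prod_beta)
  also have "\<dots> \<le> (\<Sum>t\<in>#T. d (fst (fst t)) (snd (fst t)) + d (fst (snd t)) (snd (snd t)))"
  proof (rule sum_mset_mono)
    fix t assume t: "t \<in># T"
    have "fst t \<in># M" "snd t \<in># N"
      using t T(1,2) by auto
    then have "snd (fst t) \<in># U" "snd (snd t) \<in># V" "fst (fst t) \<in># W"
      using M(1,2) N(2) by auto
    moreover have "fst (fst t) = fst (snd t)"
      using T(3) t by auto
    ultimately show "d (snd (fst t)) (snd (snd t))
        \<le> d (fst (fst t)) (snd (fst t)) + d (fst (snd t)) (snd (snd t))"
      using tri by metis
  qed
  also have "\<dots> = dk d W U + dk d W V"
    by (simp add: M(3) N(3) T(1,2)[symmetric] image_mset.compositionality comp_def case_prod_beta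
        sum_mset.distrib)
  finally show ?thesis .
qed

section \<open>Alternating paths and the four-point condition\<close>

text \<open>Regard \<open>e\<close> in \<open>E\<close> as an edge from \<open>f e\<close> to
  \<open>g e\<close>: the equation makes \<open>B\<close> the sources and \<open>C\<close> the
  sinks. A walk from \<open>x\<close> either stops at a sink or leaves along an edge, which is
  deleted while its head replaces \<open>x\<close> in \<open>B\<close>. The final equation
  expresses, in telescoped form, that \<open>I\<close> leads from \<open>x\<close> to
  \<open>v\<close>.\<close>

lemma exchange_path:
  assumes "image_mset f E + C = image_mset g E + B" and "x \<in># B"
  shows "\<exists>I v. I \<subseteq># E \<and> v \<in># C \<and> add_mset v (image_mset f I) = add_mset x (image_mset g I)"
  using assms
proof (induction "size E" arbitrary: E x B)
  case 0
  then show ?case by auto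
next
  case (Suc n)
  show ?case
  proof (cases "x \<in># C")
    case True
    then show ?thesis
      by (intro exI[of _ "{#}"] exI[of _ x]) auto
  next
    case False
    then obtain e where e: "e \<in># E" "f e = x"
      using Suc.prems by (metis (no_types, lifting) image_iff set_image_mset union_iff)
    obtain E' where E: "E = add_mset e E'"
      using e by (metis multi_member_split)
    obtain B' where B: "B = add_mset x B'"
      using Suc.prems by (metis multi_member_split)
    have "image_mset f E' + C = image_mset g E' + add_mset (g e) B'"
      using Suc.prems(1) e by (simp add: E B)
    moreover have "n = size E'"
      using Suc.hyps(2) E by simp
    ultimately obtain I v where I: "I \<subseteq># E'" "v \<in># C"
        "add_mset v (image_mset f I) = add_mset (g e) (image_mset g I)"
      using Suc.hyps(1)[of E' "add_mset (g e) B'" "g e"] by auto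
    show ?thesis
    proof (intro exI conjI)
      show "add_mset e I \<subseteq># E"
        using I E by simp
      show "v \<in># C" by fact
      show "add_mset v (image_mset f (add_mset e I)) = add_mset x (image_mset g (add_mset e I))"
        using I(3) e by (simp add: add_mset_commute)
    qed
  qed
qed

text \<open>Superimposing optimal matchings of both sides, an alternating path from \<open>x\<close> must end in
  \<open>z\<close> or \<open>w\<close>; swapping the two matchings along it costs nothing.\<close>

lemma dk_four_point:
  fixes d :: "'a \<Rightarrow> 'a \<Rightarrow> real"
  assumes sz: "size A + 2 = size V"
  shows "min (dk d (A + {#x, z#}) V + dk d (A + {#y, w#}) V)
             (dk d (A + {#x, w#}) V + dk d (A + {#y, z#}) V)
         \<le> dk d (A + {#x, y#}) V + dk d (A + {#z, w#}) V"
proof -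
  obtain M where M: "image_mset fst M = A + {#x, y#}" "image_mset snd M = V"
      "dk d (A + {#x, y#}) V = (\<Sum>(a,b)\<in>#M. d a b)"
    using dk_attained[of "A + {#x, y#}" V d] sz by auto
  obtain N where N: "image_mset fst N = A + {#z, w#}" "image_mset snd N = V"
      "dk d (A + {#z, w#}) V = (\<Sum>(a,b)\<in>#N. d a b)"
    using dk_attained[of "A + {#z, w#}" V d] sz by auto
  obtain T where T: "image_mset fst T = M" "image_mset snd T = N" "\<forall>(p,q)\<in>#T. snd p = snd q"
    using joint_matching[of snd M snd N] M N by auto
  \<comment> \<open>Each \<open>t\<close> is a point of \<open>V\<close> with its partners under
    \<open>M\<close> and \<open>N\<close>; it acts as an edge from \<open>?f t\<close> to
    \<open>?g t\<close>.\<close>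
  let ?f = "\<lambda>t. fst (fst t)" and ?g = "\<lambda>t. fst (snd t)"
  have fT: "image_mset ?f T = A + {#x, y#}"
    using M(1) by (simp add: T(1)[symmetric] image_mset.compositionality comp_def)
  have gT: "image_mset ?g T = A + {#z, w#}"
    using N(1) by (simp add: T(2)[symmetric] image_mset.compositionality comp_def)
  obtain I v where I: "I \<subseteq># T" "v \<in># {#z, w#}"
      "add_mset v (image_mset ?f I) = add_mset x (image_mset ?g I)"
    using exchange_path[of ?f T "{#z, w#}" ?g "{#x, y#}" x] fT gT by auto
  obtain J where J: "T = I + J"
    using I(1) by (metis subset_mset.le_iff_add)
  \<comment> \<open>Exchange the two matchings on the trail \<open>I\<close> and keep them on
    \<open>J\<close>.\<close>
  let ?M = "image_mset snd I + image_mset fst J"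
  let ?N = "image_mset fst I + image_mset snd J"
  have "image_mset snd (image_mset snd T) = V" "image_mset snd (image_mset fst T) = V"
    using T M N by simp_all
  moreover have "image_mset snd (image_mset snd I) = image_mset snd (image_mset fst I)"
    using T(3) J by (fastforce simp: image_mset.compositionality comp_def intro!: image_mset_cong)
  ultimately have s: "image_mset snd ?M = V" "image_mset snd ?N = V"
    by (simp_all add: J)
  have split: "A + {#x, y#} = image_mset ?f I + image_mset ?f J"
      "A + {#z, w#} = image_mset ?g I + image_mset ?g J"
    unfolding fT[symmetric] gT[symmetric] J by simp_all
  have fst_MN: "image_mset fst ?M = image_mset ?g I + image_mset ?f J"
      "image_mset fst ?N = image_mset ?f I + image_mset ?g J"
    by (simp_all add: image_mset.compositionality comp_def)
  \<comment> \<open>The trail equation \<open>I(3)\<close> has \<open>v\<close> and \<open>x\<close>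
    on opposite sides, so the new first marginals are computed with one point added to both sides
    and then cancelled.\<close>
  have fM: "add_mset x (image_mset fst ?M) = add_mset v (A + {#x, y#})"
    unfolding split fst_MN union_mset_add_mset_left[symmetric] I(3) ..
  have fN: "add_mset v (image_mset fst ?N) = add_mset x (A + {#z, w#})"
    unfolding split fst_MN union_mset_add_mset_left[symmetric] I(3) ..
  have fM': "image_mset fst ?M = A + {#v, y#}"
    using fM by (simp add: add_mset_commute)
  define v' where "v' = (if v = z then w else z)"
  have "add_mset v (image_mset fst ?N) = add_mset v (A + {#x, v'#})"
    using fN I(2) by (auto simp: v'_def add_mset_commute)
  then have fN': "image_mset fst ?N = A + {#x, v'#}"
    by simp
  have "dk d (A + {#v, y#}) V + dk d (A + {#x, v'#}) V
      \<le> (\<Sum>(a,b)\<in>#?M. d a b) + (\<Sum>(a,b)\<in>#?N. d a b)"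
    using dk_le[OF _ fM' s(1), of d] dk_le[OF _ fN' s(2), of d] sz by auto
  also have "\<dots> = (\<Sum>(a,b)\<in>#M. d a b) + (\<Sum>(a,b)\<in>#N. d a b)"
    by (simp add: T(1,2)[symmetric] J)
  finally have "dk d (A + {#v, y#}) V + dk d (A + {#x, v'#}) V
      \<le> dk d (A + {#x, y#}) V + dk d (A + {#z, w#}) V"
    using M N by simp
  then show ?thesis
    using I(2) by (auto simp: v'_def add_mset_commute split: if_splits)
qed

section \<open>Nonnegative quadratic forms: partial equivalences, ultrametric similarities, the
  matching distance\<close>

text \<open>The form is the sum of the squares of the masses that \<open>h\<close> gives to the
  classes. The sum runs over elements \<open>z\<close> instead of classes, so each term is divided
  by the size of the class; outside the domain of \<open>R\<close> it is 0 / 0 = 0.\<close>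

lemma partial_equivalence_quadratic_form_nonneg:
  fixes h :: "'a \<Rightarrow> real"
  assumes fin: "finite X"
    and sym: "\<And>x y. R x y \<Longrightarrow> R y x"
    and trans: "\<And>x y z. R x y \<Longrightarrow> R y z \<Longrightarrow> R x z"
  shows "0 \<le> (\<Sum>x\<in>X. \<Sum>y\<in>X. h x * h y * of_bool (R x y))"
proof -
  define n where "n z = real (card {u\<in>X. R u z})" for z
  have eq: "of_bool (R x y) = (\<Sum>z\<in>X. of_bool (R x z) * of_bool (R y z) / n z)"
    if "x \<in> X" "y \<in> X" for x y
  proof (cases "R x y")
    case True
    have c: "of_bool (R x z) * of_bool (R y z) / n z = (if R z x then 1 / n x else 0)" for z
    proof -
      have "R z x \<Longrightarrow> {u\<in>X. R u z} = {u\<in>X. R u x}"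
        using sym trans by blast
      moreover have "R x z \<longleftrightarrow> R z x" "R y z \<longleftrightarrow> R z x"
        using True sym trans by blast+
      ultimately show ?thesis
        by (simp add: n_def)
    qed
    have "x \<in> {u\<in>X. R u x}"
      using True sym trans that by blast
    then have "n x > 0"
      using fin by (auto simp: n_def card_gt_0_iff)
    have "(\<Sum>z\<in>X. of_bool (R x z) * of_bool (R y z) / n z) = (\<Sum>z\<in>{u\<in>X. R u x}. 1 / n x)"
      unfolding c using fin by (rule sum.inter_filter[symmetric])
    also have "\<dots> = 1"
      using \<open>n x > 0\<close> by (simp add: n_def)
    finally show ?thesis
      using True by simp
  next
    case False
    then have "\<not> (R x z \<and> R y z)" for z
      using sym trans by blast
    then show ?thesis
      using False by (simp add: sum.neutral)
  qed
  have "(\<Sum>x\<in>X. \<Sum>y\<in>X. h x * h y * of_bool (R x y))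
      = (\<Sum>x\<in>X. \<Sum>y\<in>X. \<Sum>z\<in>X. (h x * of_bool (R x z)) * (h y * of_bool (R y z)) / n z)"
    by (intro sum.cong refl, subst eq) (auto simp: sum_distrib_left mult_ac intro!: sum.cong)
  also have "\<dots> = (\<Sum>x\<in>X. \<Sum>z\<in>X. \<Sum>y\<in>X. (h x * of_bool (R x z)) * (h y * of_bool (R y z)) / n z)"
    by (intro sum.cong refl sum.swap)
  also have "\<dots> = (\<Sum>z\<in>X. \<Sum>x\<in>X. \<Sum>y\<in>X. (h x * of_bool (R x z)) * (h y * of_bool (R y z)) / n z)"
    by (rule sum.swap)
  also have "\<dots> = (\<Sum>z\<in>X. (\<Sum>x\<in>X. h x * of_bool (R x z))\<^sup>2 / n z)"
    by (simp add: power2_eq_square sum_product sum_divide_distrib)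
  also have "\<dots> \<ge> 0"
    by (intro sum_nonneg divide_nonneg_nonneg) (auto simp: n_def)
  finally show ?thesis .
qed

text \<open>The superlevel sets of \<open>s\<close> are partial equivalence relations, and \<open>s\<close> is a constant plus a
  nonnegative combination of their indicators.\<close>

lemma ultrametric_quadratic_form_nonneg:
  fixes s :: "'a \<Rightarrow> 'a \<Rightarrow> real"
  assumes fin: "finite X" and h: "(\<Sum>x\<in>X. h x) = 0"
    and sym: "\<And>x y. s x y = s y x"
    and ultra: "\<And>x y z. min (s x z) (s z y) \<le> s x y"
  shows "0 \<le> (\<Sum>x\<in>X. \<Sum>y\<in>X. h x * h y * s x y)"
proof -
  \<comment> \<open>Induction on a finite set of possible values, removing the largest;
    \<open>s\<close> must vary because each step truncates it.\<close>
  have "finite V \<Longrightarrow> (\<And>x y. x \<in> X \<Longrightarrow> y \<in> X \<Longrightarrow> s x y \<in> V) \<Longrightarrow>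
      (\<And>x y. s x y = s y x) \<Longrightarrow> (\<And>x y z. min (s x z) (s z y) \<le> s x y) \<Longrightarrow>
      0 \<le> (\<Sum>x\<in>X. \<Sum>y\<in>X. h x * h y * s x y)" for V and s :: "'a \<Rightarrow> 'a \<Rightarrow> real"
  proof (induction V arbitrary: s rule: finite_linorder_max_induct)
    case empty
    then have "X = {}" by blast
    then show ?case by simp
  next
    case (insert b V)
    show ?case
    proof (cases "V = {}")
      case True
      \<comment> \<open>A constant \<open>s\<close> contributes nothing, as \<open>h\<close> has sum
        0.\<close>
      then have "(\<Sum>x\<in>X. \<Sum>y\<in>X. h x * h y * s x y) = (\<Sum>x\<in>X. \<Sum>y\<in>X. h x * (h y * b))"
        using insert.prems(1) by (intro sum.cong refl) auto
      also have "\<dots> = 0"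
        using h by (simp flip: sum_distrib_left sum_distrib_right)
      finally show ?thesis by simp
    next
      case False
      define m where "m = Max V"
      have m: "m \<in> V" "\<And>v. v \<in> V \<Longrightarrow> v \<le> m" "m < b"
        using False insert.hyps by (auto simp: m_def)
      \<comment> \<open>On \<open>X\<close> the values are \<open>b\<close> or at most
        \<open>m\<close>, so truncation at \<open>m\<close> removes one level. The level set is
        written with \<open>b \<le>\<close> because off \<open>X\<close> the values may exceed
        \<open>b\<close>, and transitivity is required on the whole type.\<close>
      have "s x y = min (s x y) m + (b - m) * of_bool (b \<le> s x y)" if "x \<in> X" "y \<in> X" for x y
        using insert.prems(1)[OF that] m by (cases "s x y = b") fastforce+
      then have "(\<Sum>x\<in>X. \<Sum>y\<in>X. h x * h y * s x y)
          = (\<Sum>x\<in>X. \<Sum>y\<in>X. h x * h y * min (s x y) m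
              + (b - m) * (h x * h y * of_bool (b \<le> s x y)))"
        by (intro sum.cong refl) (smt (verit) distrib_left mult.left_commute)
      also have "\<dots> = (\<Sum>x\<in>X. \<Sum>y\<in>X. h x * h y * min (s x y) m)
          + (b - m) * (\<Sum>x\<in>X. \<Sum>y\<in>X. h x * h y * of_bool (b \<le> s x y))"
        by (simp add: sum.distrib sum_distrib_left)
      also have "\<dots> \<ge> 0"
      proof (intro add_nonneg_nonneg mult_nonneg_nonneg)
        show "0 \<le> (\<Sum>x\<in>X. \<Sum>y\<in>X. h x * h y * min (s x y) m)"
        proof (rule insert.IH)
          show "min (s x y) m \<in> V" if "x \<in> X" "y \<in> X" for x y
            using insert.prems(1)[OF that] m by (auto simp: min_def)
          show "min (s x y) m = min (s y x) m" for x y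
            using insert.prems(2) by metis
          show "min (min (s x z) m) (min (s z y) m) \<le> min (s x y) m" for x y z
            using insert.prems(3)[of x z y] by linarith
        qed
        show "0 \<le> b - m"
          using m by simp
        show "0 \<le> (\<Sum>x\<in>X. \<Sum>y\<in>X. h x * h y * of_bool (b \<le> s x y))"
        proof (rule partial_equivalence_quadratic_form_nonneg[OF fin])
          show "b \<le> s x y \<Longrightarrow> b \<le> s y x" for x y
            using insert.prems(2) by metis
          show "b \<le> s x y \<Longrightarrow> b \<le> s y z \<Longrightarrow> b \<le> s x z" for x y z
            using insert.prems(3)[of x y z] by linarith
        qed
      qed
      finally show ?thesis .
    qed
  qed
  from this[of "(\<lambda>(x,y). s x y) ` (X \<times> X)" s, OF _ _ sym ultra] show ?thesis
    using fin by auto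
qed

text \<open>A form of negative dependence: moving two independent draws closer in law increases the
  expectation of such a \<open>g\<close>.\<close>

definition pair_psd :: "'a set \<Rightarrow> nat \<Rightarrow> ('a multiset \<Rightarrow> real) \<Rightarrow> bool" where
  "pair_psd X k g \<longleftrightarrow> (\<forall>M h. size M + 2 = k \<longrightarrow> set_mset M \<subseteq> X \<longrightarrow> (\<Sum>x\<in>X. h x) = 0 \<longrightarrow>
     0 \<le> (\<Sum>x\<in>X. \<Sum>y\<in>X. h x * h y * g (M + {#x, y#})))"

text \<open>Subtracting the \<open>w\<close> terms (a Farris transform with base point
  \<open>w\<close>) leaves the form unchanged: each depends on one variable only, and
  \<open>h\<close> has sum 0. After adding \<open>K x w + K y w + K z w\<close>, the ultrametric
  inequality becomes the four-point condition.\<close>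

lemma pair_psd_dk:
  fixes d :: "'a \<Rightarrow> 'a \<Rightarrow> real"
  assumes fin: "finite X"
  shows "pair_psd X (size V) (\<lambda>U. dk d U V)"
  unfolding pair_psd_def
proof (intro allI impI)
  fix M and h :: "'a \<Rightarrow> real" assume sz: "size M + 2 = size V" and "set_mset M \<subseteq> X" and h: "(\<Sum>x\<in>X. h x) = 0"
  define K where "K x y = dk d (M + {#x, y#}) V" for x y
  \<comment> \<open>Any base point will do, also one outside \<open>X\<close>.\<close>
  obtain w :: 'a where True by simp
  have K_sym: "K x y = K y x" for x y
    by (simp add: K_def add_mset_commute)
  have "(\<Sum>x\<in>X. \<Sum>y\<in>X. h x * h y * K x y)
      = (\<Sum>x\<in>X. \<Sum>y\<in>X. h x * h y * (K x y - K x w - K y w) + h x * K x w * h y + h x * (h y * K y w))"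
    by (intro sum.cong refl) (simp add: algebra_simps)
  also have "\<dots> = (\<Sum>x\<in>X. \<Sum>y\<in>X. h x * h y * (K x y - K x w - K y w))"
    using h by (simp add: sum.distrib flip: sum_distrib_left sum_distrib_right)
  also have "\<dots> \<ge> 0"
  proof (rule ultrametric_quadratic_form_nonneg[OF fin h])
    show "K x y - K x w - K y w = K y x - K y w - K x w" for x y
      using K_sym[of x y] by simp
    show "min (K x z - K x w - K z w) (K z y - K z w - K y w) \<le> K x y - K x w - K y w" for x y z
      using dk_four_point[OF sz, of d x z y w] K_sym[of z y] unfolding K_def by linarith
  qed
  finally show "0 \<le> (\<Sum>x\<in>X. \<Sum>y\<in>X. h x * h y * dk d (M + {#x, y#}) V)"
    by (simp add: K_def)
qed

section \<open>Means over independent draws with differing laws\<close>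

text \<open>The mean of \<open>g\<close> over multisets of independent draws, one from each of the weight functions in
  the list. Unlike \<open>iid_mset\<close>, the laws may differ.\<close>

fun mean_draws :: "'a set \<Rightarrow> ('a \<Rightarrow> real) list \<Rightarrow> ('a multiset \<Rightarrow> real) \<Rightarrow> real" where
  "mean_draws X [] g = g {#}"
| "mean_draws X (w # ws) g = (\<Sum>x\<in>X. w x * mean_draws X ws (\<lambda>M. g (add_mset x M)))"

text \<open>Real functions instead of pmfs allow laws to be combined linearly; only values on
  \<open>X\<close> count.\<close>

definition prob_weight :: "'a set \<Rightarrow> ('a \<Rightarrow> real) \<Rightarrow> bool" where
  "prob_weight X w \<longleftrightarrow> (\<forall>x\<in>X. 0 \<le> w x) \<and> sum w X = 1"

lemma mean_draws_cong:
  assumes "list_all2 (\<lambda>w v. \<forall>x\<in>X. w x = v x) ws vs"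
    and "\<And>M. M \<in> kmsets X (length ws) \<Longrightarrow> g M = g' M"
  shows "mean_draws X ws g = mean_draws X vs g'"
  using assms
proof (induction arbitrary: g g' rule: list_all2_induct)
  case Nil
  then show ?case by (simp add: kmsets_def)
next
  case (Cons w ws v vs)
  have "mean_draws X ws (\<lambda>M. g (add_mset x M)) = mean_draws X vs (\<lambda>M. g' (add_mset x M))" if "x \<in> X" for x
    using that by (intro Cons.IH Cons.prems) (auto simp: kmsets_def)
  then show ?case
    using Cons.hyps by (auto intro!: sum.cong)
qed

lemma mean_draws_mono:
  assumes "\<And>w. w \<in> set ws \<Longrightarrow> prob_weight X w"
    and "\<And>M. M \<in> kmsets X (length ws) \<Longrightarrow> g M \<le> g' M"
  shows "mean_draws X ws g \<le> mean_draws X ws g'"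
  using assms
proof (induction ws arbitrary: g g')
  case Nil
  then show ?case by (simp add: kmsets_def)
next
  case (Cons w ws)
  have "mean_draws X ws (\<lambda>M. g (add_mset x M)) \<le> mean_draws X ws (\<lambda>M. g' (add_mset x M))" if "x \<in> X" for x
    using that by (intro Cons.IH Cons.prems) (auto simp: kmsets_def)
  moreover have "\<forall>x\<in>X. 0 \<le> w x"
    using Cons.prems(1)[of w] by (simp add: prob_weight_def)
  ultimately show ?case
    by (auto intro!: sum_mono mult_left_mono)
qed

lemma mean_draws_const:
  assumes "\<And>w. w \<in> set ws \<Longrightarrow> prob_weight X w"
  shows "mean_draws X ws (\<lambda>M. c) = c"
  using assms by (induction ws) (simp_all add: prob_weight_def flip: sum_distrib_right)

lemma mean_draws_add:
  "mean_draws X ws (\<lambda>M. f M + g M) = mean_draws X ws f + mean_draws X ws g"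
  by (induction ws arbitrary: f g) (simp_all add: algebra_simps sum.distrib)

lemma mean_draws_sum:
  "mean_draws X ws (\<lambda>M. \<Sum>i\<in>I. c i * g i M) = (\<Sum>i\<in>I. c i * mean_draws X ws (g i))"
proof (induction ws arbitrary: g)
  case Nil
  then show ?case by simp
next
  case (Cons w ws)
  have "mean_draws X (w # ws) (\<lambda>M. \<Sum>i\<in>I. c i * g i M)
      = (\<Sum>x\<in>X. \<Sum>i\<in>I. c i * (w x * mean_draws X ws (\<lambda>M. g i (add_mset x M))))"
    by (simp add: Cons.IH sum_distrib_left mult.left_commute)
  also have "\<dots> = (\<Sum>i\<in>I. c i * mean_draws X (w # ws) (g i))"
    by (subst sum.swap) (simp add: sum_distrib_left)
  finally show ?case .
qed

lemma mean_draws_quadratic_form: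
  "mean_draws X ws (\<lambda>M. \<Sum>x\<in>I. \<Sum>y\<in>J. h x * h y * g x y M)
     = (\<Sum>x\<in>I. \<Sum>y\<in>J. h x * h y * mean_draws X ws (g x y))"
  using mean_draws_sum[of X ws "\<lambda>p. h (fst p) * h (snd p)" "\<lambda>p. g (fst p) (snd p)" "I \<times> J"]
  by (simp add: sum.cartesian_product case_prod_beta)

lemma mean_draws_move: "mean_draws X (us @ v # ws) g = mean_draws X (v # us @ ws) g"
proof (induction us arbitrary: g)
  case Nil
  then show ?case by simp
next
  case (Cons u us)
  show ?case
    by (simp add: Cons.IH sum_distrib_left)
      (subst sum.swap, simp add: mult.left_commute add_mset_commute)
qed

text \<open>Finite Fubini, as \<open>g\<close> sees only the multiset of draws. It lets the
  averaging argument bring any two laws to the front.\<close>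

lemma mean_draws_perm:
  assumes "mset us = mset ws"
  shows "mean_draws X us g = mean_draws X ws g"
  using assms
proof (induction us arbitrary: ws g)
  case Nil
  then show ?case by simp
next
  case (Cons u us)
  then obtain as bs where ws: "ws = as @ u # bs"
    by (metis list.set_intros(1) set_mset_mset split_list)
  then have "mset us = mset (as @ bs)"
    using Cons.prems by simp
  then show ?case
    unfolding ws mean_draws_move mean_draws.simps(2) by (simp only: Cons.IH)
qed

lemma mean_draws_point_masses:
  assumes "finite X" "set xs \<subseteq> X"
  shows "mean_draws X (map (\<lambda>a x. of_bool (x = a)) xs @ ws) g
     = mean_draws X ws (\<lambda>M. g (mset xs + M))"
  using assms(2)
proof (induction xs arbitrary: g)
  case Nil
  then show ?case by simp
next
  case (Cons a xs)
  have "(\<Sum>x\<in>X. of_bool (x = a) * F x) = (F a :: real)" for F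
    using assms(1) Cons.prems by (simp add: of_bool_def if_distrib[of "\<lambda>z. z * _"] cong: if_cong)
  then show ?case
    using Cons by simp
qed

text \<open>The form of a mean is the mean of the forms. This carries positivity from
  \<open>dk\<close> with a fixed second argument to \<open>rp_cost\<close>.\<close>

lemma pair_psd_mean_draws:
  assumes "\<And>v. v \<in> set vs \<Longrightarrow> prob_weight X v"
    and "\<And>Y. Y \<in> kmsets X (length vs) \<Longrightarrow> pair_psd X k (\<lambda>M. g M Y)"
  shows "pair_psd X k (\<lambda>M. mean_draws X vs (g M))"
  unfolding pair_psd_def
proof (intro allI impI)
  fix M and h :: "'a \<Rightarrow> real"
  assume *: "size M + 2 = k" "set_mset M \<subseteq> X" "(\<Sum>x\<in>X. h x) = 0"
  have "0 = mean_draws X vs (\<lambda>Y. 0)"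
    using assms(1) by (simp add: mean_draws_const)
  also have "\<dots> \<le> mean_draws X vs (\<lambda>Y. \<Sum>x\<in>X. \<Sum>y\<in>X. h x * h y * g (M + {#x, y#}) Y)"
    using assms * unfolding pair_psd_def by (intro mean_draws_mono) blast+
  finally show "0 \<le> (\<Sum>x\<in>X. \<Sum>y\<in>X. h x * h y * mean_draws X vs (g (M + {#x, y#})))"
    by (simp only: mean_draws_quadratic_form)
qed

section \<open>Averaging independent laws increases the mean\<close>

text \<open>The sum of the two laws is kept. Since \<open>K\<close> is symmetric, the terms linear
  in \<open>e\<close> cancel in the difference of the two means, and the gain is
  \<open>t * (1 - t)\<close> times the form at \<open>e\<close>.\<close>

lemma mean_draws_pair_transfer:
  assumes ws: "\<And>w. w \<in> set ws \<Longrightarrow> prob_weight X w"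
    and psd: "pair_psd X (length ws + 2) g"
    and e: "(\<Sum>x\<in>X. e x) = 0" and t: "0 \<le> t" "t \<le> 1"
  shows "mean_draws X (m # (\<lambda>x. m x + e x) # ws) g
     \<le> mean_draws X ((\<lambda>x. m x + t * e x) # (\<lambda>x. m x + (1 - t) * e x) # ws) g"
proof -
  define K where "K x y = mean_draws X ws (\<lambda>M. g (M + {#x, y#}))" for x y
  have K_sym: "K x y = K y x" for x y
    by (simp add: K_def add_mset_commute)
  have expand: "mean_draws X (u # v # ws) g = (\<Sum>x\<in>X. \<Sum>y\<in>X. u x * v y * K x y)" for u v
    by (simp add: K_def sum_distrib_left mult.assoc add_mset_commute)
  have "0 = mean_draws X ws (\<lambda>M. 0)"
    using ws by (simp add: mean_draws_const)
  also have "\<dots> \<le> mean_draws X ws (\<lambda>M. \<Sum>x\<in>X. \<Sum>y\<in>X. e x * e y * g (M + {#x, y#}))"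
    using ws psd e unfolding pair_psd_def by (intro mean_draws_mono) (auto simp: kmsets_def)
  finally have pos: "0 \<le> (\<Sum>x\<in>X. \<Sum>y\<in>X. e x * e y * K x y)"
    by (simp only: mean_draws_quadratic_form K_def)
  have sym: "(\<Sum>x\<in>X. \<Sum>y\<in>X. e x * m y * K x y) = (\<Sum>x\<in>X. \<Sum>y\<in>X. m x * e y * K x y)"
    by (subst sum.swap) (simp add: K_sym mult.commute)
  have "(\<Sum>x\<in>X. \<Sum>y\<in>X. (m x + t * e x) * (m y + (1 - t) * e y) * K x y)
      = (\<Sum>x\<in>X. \<Sum>y\<in>X. m x * (m y + e y) * K x y + t * (e x * m y * K x y)
           - t * (m x * e y * K x y) + t * (1 - t) * (e x * e y * K x y))"
    by (intro sum.cong refl) (simp add: algebra_simps)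
  also have "\<dots> = (\<Sum>x\<in>X. \<Sum>y\<in>X. m x * (m y + e y) * K x y)
      + t * (1 - t) * (\<Sum>x\<in>X. \<Sum>y\<in>X. e x * e y * K x y)"
    by (simp add: sum.distrib sum_subtractf sym flip: sum_distrib_left)
  finally show ?thesis
    using pos t unfolding expand by simp
qed

lemma prob_weight_convex:
  assumes "prob_weight X m" "prob_weight X q" "0 \<le> t" "t \<le> 1"
  shows "prob_weight X (\<lambda>x. m x + t * (q x - m x))"
proof -
  have "m x + t * (q x - m x) = (1 - t) * m x + t * q x" for x
    by (simp add: algebra_simps)
  then show ?thesis
    using assms by (simp add: prob_weight_def sum.distrib flip: sum_distrib_left)
qed

text \<open>One transfer turns a copy of \<open>m\<close> into the overall average and
  \<open>q\<close> into \<open>q'\<close>. The sum of the laws is kept, so \<open>q'\<close> and the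
  other \<open>j\<close> copies of \<open>m\<close> have the same average, and induction merges them
  while the finished law waits in \<open>ws\<close>.\<close>

lemma mean_draws_merge:
  assumes "prob_weight X m" "prob_weight X q" "\<And>w. w \<in> set ws \<Longrightarrow> prob_weight X w"
    and "pair_psd X (Suc j + length ws) g"
  shows "mean_draws X (replicate j m @ q # ws) g
     \<le> mean_draws X (replicate (Suc j) (\<lambda>x. (j * m x + q x) / Suc j) @ ws) g"
  using assms(2-)
proof (induction j arbitrary: q ws)
  case 0
  then show ?case by simp
next
  case (Suc j)
  \<comment> \<open>There are \<open>j + 2\<close> laws to merge, and this \<open>t\<close> makes
    \<open>A\<close> their average.\<close>
  define t :: real where "t = 1 / (j + 2)"
  have t: "0 \<le> t" "t \<le> 1"
    by (simp_all add: t_def)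
  define A where "A = (\<lambda>x. m x + t * (q x - m x))"
  define q' where "q' = (\<lambda>x. m x + (1 - t) * (q x - m x))"
  have A: "prob_weight X A" and q': "prob_weight X q'"
    using prob_weight_convex[OF assms(1) Suc.prems(1)] t by (simp_all add: A_def q'_def)
  have A_eq: "(\<lambda>x. (real (Suc j) * m x + q x) / real (Suc (Suc j))) = A"
    by (rule ext) (simp add: A_def t_def field_simps)
  have q'_eq: "(\<lambda>x. (real j * m x + q' x) / real (Suc j)) = A"
    by (rule ext) (simp add: A_def q'_def t_def divide_simps, simp add: algebra_simps)
  have "mean_draws X (replicate (Suc j) m @ q # ws) g
      = mean_draws X (m # (\<lambda>x. m x + (q x - m x)) # replicate j m @ ws) g"
    by (rule mean_draws_perm) simp
  also have "\<dots> \<le> mean_draws X (A # q' # replicate j m @ ws) g"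
    unfolding A_def q'_def using assms(1) Suc.prems t
    by (intro mean_draws_pair_transfer) (auto simp: prob_weight_def sum_subtractf)
  also have "\<dots> = mean_draws X (replicate j m @ q' # A # ws) g"
    by (rule mean_draws_perm) simp
  also have "\<dots> \<le> mean_draws X (replicate (Suc j) A @ A # ws) g"
    using Suc.IH[of q' "A # ws"] A q' Suc.prems unfolding q'_eq by auto
  also have "\<dots> = mean_draws X (replicate (Suc (Suc j)) A @ ws) g"
    by (rule mean_draws_perm) simp
  finally show ?case
    unfolding A_eq .
qed

text \<open>The block of equal laws absorbs the laws of \<open>ws\<close> one at a time by
  \<open>mean_draws_merge\<close>. Starting from \<open>j = 0\<close> compares an arbitrary list
  with copies of its average.\<close>

lemma mean_draws_le_average:
  assumes "prob_weight X m" "\<And>w. w \<in> set ws \<Longrightarrow> prob_weight X w"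
    and "pair_psd X (j + length ws) g" "0 < j + length ws"
  shows "mean_draws X (replicate j m @ ws) g
     \<le> mean_draws X (replicate (j + length ws)
          (\<lambda>x. (j * m x + (\<Sum>w\<leftarrow>ws. w x)) / (j + length ws))) g"
  using assms
proof (induction ws arbitrary: j m)
  case Nil
  then show ?case by simp
next
  case (Cons q ws)
  define A where "A = (\<lambda>x. (j * m x + q x) / Suc j)"
  have "A = (\<lambda>x. m x + 1 / Suc j * (q x - m x))"
    by (rule ext) (simp add: A_def field_simps)
  then have A: "prob_weight X A"
    using prob_weight_convex[of X m q "1 / Suc j"] Cons.prems by simp
  have eq: "(\<lambda>x. (real (Suc j) * A x + (\<Sum>w\<leftarrow>ws. w x)) / (Suc j + length ws))
      = (\<lambda>x. (real j * m x + (\<Sum>w\<leftarrow>q # ws. w x)) / (j + length (q # ws)))"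
    by (rule ext) (simp add: A_def add.assoc)
  have "mean_draws X (replicate j m @ q # ws) g \<le> mean_draws X (replicate (Suc j) A @ ws) g"
    unfolding A_def using Cons.prems by (intro mean_draws_merge) auto
  also have "\<dots> \<le> mean_draws X (replicate (Suc j + length ws)
      (\<lambda>x. (real (Suc j) * A x + (\<Sum>w\<leftarrow>ws. w x)) / (Suc j + length ws))) g"
    using Cons.prems A by (intro Cons.IH) auto
  finally show ?case
    unfolding eq by simp
qed

section \<open>The output of VRRP as independent draws\<close>

lemma finite_set_iid_mset: "finite (set_pmf Q) \<Longrightarrow> finite (set_pmf (iid_mset Q n))"
  by (induction n) auto

lemma expectation_iid_mset:
  fixes g :: "'a multiset \<Rightarrow> real"
  assumes "finite X" "set_pmf Q \<subseteq> X"
  shows "measure_pmf.expectation (iid_mset Q n) g = mean_draws X (replicate n (pmf Q)) g"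
proof (induction n arbitrary: g)
  case 0
  then show ?case by simp
next
  case (Suc n)
  have "finite (set_pmf Q)"
    using assms finite_subset by blast
  then show ?case
    using assms by (simp add: pmf_expectation_bind[of X] finite_set_iid_mset Suc.IH)
qed

lemma count_vr_fixed:
  assumes "finite X" "x \<in> X"
  shows "count (vr_fixed X P k) x = nat \<lfloor>pmf P x * real k\<rfloor>"
  using assms by (simp add: vr_fixed_def count_sum)

lemma set_vr_fixed: "finite X \<Longrightarrow> set_mset (vr_fixed X P k) \<subseteq> X"
  by (auto simp: vr_fixed_def set_mset_sum)

lemma size_vr_fixed:
  assumes "finite X"
  shows "size (vr_fixed X P k) = (\<Sum>x\<in>X. nat \<lfloor>pmf P x * real k\<rfloor>)"
  using assms by (induction X) (simp_all add: vr_fixed_def)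

lemma vr_resid_weight_nonneg: "0 \<le> vr_resid_weight P k x"
proof (cases "k = 0")
  case False
  have "real (nat \<lfloor>pmf P x * real k\<rfloor>) \<le> pmf P x * real k"
    by simp
  then show ?thesis
    using False by (simp add: vr_resid_weight_def field_simps)
qed (simp add: vr_resid_weight_def)

lemma sum_vr_resid_weight:
  assumes "finite X" "set_pmf P \<subseteq> X"
  shows "(\<Sum>x\<in>X. vr_resid_weight P k x) = 1 - size (vr_fixed X P k) / k"
  using assms by (simp add: vr_resid_weight_def sum_subtractf size_vr_fixed sum_pmf_eq_1
      flip: sum_divide_distrib)

text \<open>\<open>embed_pmf\<close> is meaningful only for a nonnegative function of total mass 1,
  so the weights must not all vanish. In \<open>expectation_vrrp\<close> their sum is
  \<open>r / k\<close>, positive exactly when points remain to be drawn.\<close>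

lemma pmf_vr_resid:
  assumes "finite X" and pos: "0 < (\<Sum>y\<in>X. vr_resid_weight P k y)"
  shows "pmf (vr_resid X P k) x
    = (if x \<in> X then vr_resid_weight P k x / (\<Sum>y\<in>X. vr_resid_weight P k y) else 0)"
proof -
  let ?f = "\<lambda>x. if x \<in> X then vr_resid_weight P k x / (\<Sum>y\<in>X. vr_resid_weight P k y) else 0"
  have nonneg: "0 \<le> ?f x" for x
    using pos by (simp add: vr_resid_weight_nonneg)
  have "(\<integral>\<^sup>+x. ennreal (?f x) \<partial>count_space UNIV) = (\<Sum>x\<in>X. ennreal (?f x))"
    using assms(1) by (intro nn_integral_count_space') auto
  also have "\<dots> = ennreal (\<Sum>x\<in>X. ?f x)"
    using nonneg by (intro sum_ennreal)
  also have "(\<Sum>x\<in>X. ?f x) = 1"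
    using pos by (simp flip: sum_divide_distrib)
  finally show ?thesis
    unfolding vr_resid_def using nonneg by (subst pmf_embed_pmf) auto
qed

text \<open>The copies that VRRP places deterministically are draws from point masses; together with the
  residual draws these \<open>k\<close> laws average to \<open>P\<close>.\<close>

lemma expectation_vrrp:
  assumes fin: "finite X" and P: "set_pmf P \<subseteq> X" and k: "1 \<le> k"
  obtains ws where "length ws = k" "\<And>w. w \<in> set ws \<Longrightarrow> prob_weight X w"
    "\<And>x. x \<in> X \<Longrightarrow> (\<Sum>w\<leftarrow>ws. w x) = k * pmf P x"
    "\<And>g :: 'a multiset \<Rightarrow> real. measure_pmf.expectation (vrrp X P k) g = mean_draws X ws g"
proof -
  obtain xs where xs: "mset xs = vr_fixed X P k"
    by (metis ex_mset)
  let ?W = "\<Sum>y\<in>X. vr_resid_weight P k y"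
  define r where "r = k - size (vr_fixed X P k)"
  have "0 \<le> ?W"
    by (simp add: sum_nonneg vr_resid_weight_nonneg)
  \<comment> \<open>The total residual weight is nonnegative, so the natural-number subtraction in
    \<open>r\<close> does not truncate.\<close>
  then have "size (vr_fixed X P k) \<le> k"
    using k by (simp add: sum_vr_resid_weight[OF fin P] field_simps)
  then have r: "?W = r / k" "length xs + r = k"
    using k xs by (simp_all add: sum_vr_resid_weight[OF fin P] r_def field_simps flip: size_mset)
  have xs_X: "set xs \<subseteq> X"
    using set_vr_fixed[OF fin, of P k] by (simp flip: xs)
  define ws where "ws = map (\<lambda>a x. of_bool (x = a)) xs @ replicate r (pmf (vr_resid X P k))"
  have resid: "set_pmf (vr_resid X P k) \<subseteq> X"
      "x \<in> X \<Longrightarrow> r * pmf (vr_resid X P k) x = k * vr_resid_weight P k x" if "0 < r" for x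
    using that k r(1) pmf_vr_resid[OF fin, of P k] by (auto simp: set_pmf_eq split: if_splits)
  \<comment> \<open>When nothing remains to be drawn, \<open>vr_resid\<close> is unspecified, but
    the nonnegative weights have sum 0. So each \<open>pmf P x * k\<close> is an integer and the
    fixed copies alone average to \<open>P\<close>.\<close>
  have resid0: "k * vr_resid_weight P k x = 0" if "r = 0" "x \<in> X" for x
    using that r(1) fin sum_nonneg_eq_0_iff[of X "vr_resid_weight P k"]
    by (simp add: vr_resid_weight_nonneg)
  show thesis
  proof
    show "length ws = k"
      using r by (simp add: ws_def)
    show "prob_weight X w" if "w \<in> set ws" for w
    proof -
      consider a where "a \<in> X" "w = (\<lambda>x. of_bool (x = a))"
        | "0 < r" "w = pmf (vr_resid X P k)"
        using \<open>w \<in> set ws\<close> xs_X by (auto simp: ws_def)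
      then show ?thesis
      proof cases
        case 1
        then show ?thesis
          using fin by (simp add: prob_weight_def of_bool_def)
      next
        case 2
        then show ?thesis
          using fin resid by (simp add: prob_weight_def sum_pmf_eq_1)
      qed
    qed
    show "(\<Sum>w\<leftarrow>ws. w x) = k * pmf P x" if x: "x \<in> X" for x
    proof -
      have "(\<Sum>a\<leftarrow>xs. of_bool (x = a)) = real (count (mset xs) x)"
        by (induction xs) auto
      then have "(\<Sum>w\<leftarrow>ws. w x)
          = real (nat \<lfloor>pmf P x * real k\<rfloor>) + r * pmf (vr_resid X P k) x"
        using x fin by (simp add: ws_def comp_def xs count_vr_fixed sum_list_replicate)
      also have "r * pmf (vr_resid X P k) x = k * vr_resid_weight P k x"
        using resid(2)[OF _ x] resid0[OF _ x] by (cases "r = 0") auto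
      finally show ?thesis
        using k by (simp add: vr_resid_weight_def right_diff_distrib)
    qed
    show "measure_pmf.expectation (vrrp X P k) g = mean_draws X ws g" for g :: "'a multiset \<Rightarrow> real"
    proof -
      have "measure_pmf.expectation (vrrp X P k) g
          = measure_pmf.expectation (iid_mset (vr_resid X P k) r) (\<lambda>M. g (mset xs + M))"
        by (simp add: vrrp_def r_def xs)
      also have "\<dots> = mean_draws X (replicate r (pmf (vr_resid X P k))) (\<lambda>M. g (mset xs + M))"
      proof (cases "r = 0")
        case False
        then show ?thesis
          using expectation_iid_mset fin resid(1) by blast
      qed simp
      also have "\<dots> = mean_draws X ws g"
        unfolding ws_def using fin xs_X by (rule mean_draws_point_masses[symmetric])
      finally show ?thesis .
    qed
  qed
qed

section \<open>Comparison with i.i.d. sampling and the final bound\<close>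

theorem theorem4:
  fixes X :: "'a set" and d :: "'a \<Rightarrow> 'a \<Rightarrow> real" and P :: "'a pmf"
    and k :: nat and Opt :: "'a multiset"
  assumes "finite_metric_space X d"
    and "set_pmf P \<subseteq> X"
    and "k \<ge> 1"
    and "Opt \<in> kmsets X k"
    and "\<forall>S\<in>kmsets X k. rp_cost d P k Opt \<le> rp_cost d P k S"
  shows "measure_pmf.expectation (vrrp X P k) (\<lambda>S. rp_cost d P k S)
           \<le> 4 * rp_cost d P k Opt"
proof -
  have fin: "finite X"
    and sym: "\<And>x y. x \<in> X \<Longrightarrow> y \<in> X \<Longrightarrow> d x y = d y x"
    and tri: "\<And>x y z. x \<in> X \<Longrightarrow> y \<in> X \<Longrightarrow> z \<in> X \<Longrightarrow> d x z \<le> d x y + d y z"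
    and refl: "\<And>x. x \<in> X \<Longrightarrow> d x x = 0"
    using assms(1) unfolding finite_metric_space_def by blast+
  have d_nonneg: "0 \<le> d x y" if "x \<in> X" "y \<in> X" for x y
    using tri[of x y x] sym[of x y] refl[of x] that by simp
  have pP: "prob_weight X (pmf P)"
    using fin assms(2) by (simp add: prob_weight_def sum_pmf_eq_1)
  let ?Ps = "replicate k (pmf P)"
  have cost: "rp_cost d P k S = mean_draws X ?Ps (dk d S)" for S
    unfolding rp_cost_def using fin assms(2) by (rule expectation_iid_mset)
  obtain ws where ws: "length ws = k" "\<And>w. w \<in> set ws \<Longrightarrow> prob_weight X w"
      "\<And>x. x \<in> X \<Longrightarrow> (\<Sum>w\<leftarrow>ws. w x) = k * pmf P x"
      "\<And>g :: 'a multiset \<Rightarrow> real. measure_pmf.expectation (vrrp X P k) g = mean_draws X ws g"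
    using expectation_vrrp[OF fin assms(2,3)] by blast
  have psd: "pair_psd X k (rp_cost d P k)"
    unfolding cost
  proof (rule pair_psd_mean_draws)
    show "pair_psd X k (\<lambda>M. dk d M Y)" if "Y \<in> kmsets X (length ?Ps)" for Y
      using pair_psd_dk[OF fin, of Y d] that by (simp add: kmsets_def)
  qed (use pP in auto)
  have nonneg: "0 \<le> rp_cost d P k Opt"
  proof -
    have "0 \<le> dk d Opt Y" if "Y \<in> kmsets X k" for Y
      using that assms(4) d_nonneg by (intro dk_nonneg) (auto simp: kmsets_def)
    then have "mean_draws X ?Ps (\<lambda>Y. 0) \<le> rp_cost d P k Opt"
      unfolding cost using pP by (intro mean_draws_mono) auto
    then show ?thesis
      using pP by (subst (asm) mean_draws_const) auto
  qed
  have "measure_pmf.expectation (vrrp X P k) (rp_cost d P k) = mean_draws X ws (rp_cost d P k)"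
    by (rule ws(4))
  \<comment> \<open>The averaging lemma starts from the empty block \<open>j = 0\<close>; the
    average of \<open>ws\<close> is then identified with \<open>P\<close> on
    \<open>X\<close>.\<close>
  also have "\<dots> \<le> mean_draws X (replicate k (\<lambda>x. (\<Sum>w\<leftarrow>ws. w x) / k)) (rp_cost d P k)"
    using mean_draws_le_average[of X "pmf P" ws 0 "rp_cost d P k"] pP ws(1,2) psd assms(3) by simp
  also have "\<dots> = mean_draws X ?Ps (rp_cost d P k)"
    using ws(3) assms(3) by (intro mean_draws_cong) (auto simp: list_all2_conv_all_nth)
  \<comment> \<open>Both \<open>S\<close> and the sample inside \<open>rp_cost\<close> are now
    i.i.d. from \<open>P\<close>, so the two legs of the detour through \<open>Opt\<close> have the
    same mean.\<close>
  also have "\<dots> \<le> mean_draws X ?Ps (\<lambda>S. dk d Opt S + rp_cost d P k Opt)"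
  proof (rule mean_draws_mono)
    fix S assume "S \<in> kmsets X (length ?Ps)"
    then have S: "S \<in> kmsets X k" by simp
    have "dk d S Y \<le> dk d Opt S + dk d Opt Y" if "Y \<in> kmsets X k" for Y
    proof (rule dk_triangle)
      show "d a b \<le> d c a + d c b" if "a \<in># S" "b \<in># Y" "c \<in># Opt" for a b c
      proof -
        have "a \<in> X" "b \<in> X" "c \<in> X"
          using that S \<open>Y \<in> kmsets X k\<close> assms(4) by (auto simp: kmsets_def)
        then show ?thesis
          using tri[of a c b] sym[of a c] by simp
      qed
    qed (use that S assms(4) in \<open>auto simp: kmsets_def\<close>)
    then have "rp_cost d P k S \<le> mean_draws X ?Ps (\<lambda>Y. dk d Opt S + dk d Opt Y)"
      unfolding cost using pP by (intro mean_draws_mono) auto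
    also have "\<dots> = dk d Opt S + rp_cost d P k Opt"
      using pP by (subst mean_draws_add, subst mean_draws_const) (auto simp: cost)
    finally show "rp_cost d P k S \<le> dk d Opt S + rp_cost d P k Opt" .
  qed (use pP in auto)
  also have "\<dots> = 2 * rp_cost d P k Opt"
    using pP by (subst mean_draws_add, subst mean_draws_const) (auto simp: cost)
  \<comment> \<open>Nonnegativity of the cost relaxes the factor 2 to 4.\<close>
  also have "\<dots> \<le> 4 * rp_cost d P k Opt"
    using nonneg by simp
  finally show ?thesis .
qed

end
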